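(* Let $q=p^e>4$, where $p$ is a prime, and let $\ell$ be a positive integer with $2\ell\mid e$. Let $x_1,x_2$ be positive integers satisfying $(q-1)\mid\operatorname{lcm}(x_1,x_2)$ and $\frac{q-1}{p^\ell-1}\mid x_1$. Let $n=r_1\frac{q-1}{\gcd(x_2,q-1)}$, where $1\le r_1\le\frac{q-1}{\gcd(x_1,q-1)}$, and let $s\ge1$. Then, for every integer $k$ with $s+1\le k\le\left\lfloor\frac{p^\ell+n}{p^\ell+1}\right\rfloor$ and every integer $h$ with $0\le h\le k-s-1$, there exists an $[n+s,k]_q$ generalized Roth-Lempel code $C$ such that $\dim\bigl(\operatorname{Hull}_{\ell}(C)\bigr)=h$.
   Context: For $q=p^e$ and $0\le\ell\le e-1$, the $\ell$-Galois inner product on $\mathbb F_q^N$ is $\langle\boldsymbol x,\boldsymbol y\rangle_\ell=\sum_i x_iy_i^{p^\ell}$. For a linear code $C\subseteq\mathbb F_q^N$, $C^{\perp_\ell}=\{\boldsymbol x\in\mathbb F_q^N:\langle\boldsymbol c,\boldsymbol x\rangle_\ell=0\ \text{for all }\boldsymbol c\in C\}$ and $\operatorname{Hull}_\ell(C)=C\cap C^{\perp_\ell}$. An $[n+s,k]_q$ generalized Roth-Lempel (GRL) code, where $1\le s\le k\le n$, is a code of the form $$\operatorname{GRL}_k(\boldsymbol a,\boldsymbol v,A_s)=\{(v_1f(a_1),\ldots,v_nf(a_n),(f_{k-s},\ldots,f_{k-1})A_s): f(x)=\textstyle\sum_{j=0}^{k-1}f_jx^j\in\mathbb F_q[x]\},$$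 where $\boldsymbol a\in\mathbb F_q^n$ has pairwise distinct entries, $\boldsymbol v\in(\mathbb F_q^* )^n$ and $A_s\in\operatorname{GL}_s(\mathbb F_q)$. *)

theory Defs
  imports "Jordan_Normal_Form.VS_Connect" "HOL-Library.Cardinality"
begin

text \<open>The ambient space \<open>F^N\<close> is \<^term>\<open>carrier_vec N\<close> over a type of class \<open>{field, finite}\<close>.
  In the Galois notions, \<open>p\<close> is meant to be the characteristic of the field.\<close>

definition galois_inner :: "nat \<Rightarrow> nat \<Rightarrow> 'a::field vec \<Rightarrow> 'a vec \<Rightarrow> 'a" where
  "galois_inner p l x y = (\<Sum>i<dim_vec y. x $ i * (y $ i) ^ (p ^ l))"

definition galois_dual :: "nat \<Rightarrow> nat \<Rightarrow> nat \<Rightarrow> 'a::field vec set \<Rightarrow> 'a vec set" where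
  "galois_dual p l N C = {x \<in> carrier_vec N. \<forall>c\<in>C. galois_inner p l c x = 0}"

definition galois_hull :: "nat \<Rightarrow> nat \<Rightarrow> nat \<Rightarrow> 'a::field vec set \<Rightarrow> 'a vec set" where
  "galois_hull p l N C = C \<inter> galois_dual p l N C"

text \<open>Meaningful only when \<open>W\<close> is a subspace of \<^term>\<open>carrier_vec N\<close>.\<close>

definition subspace_dim :: "nat \<Rightarrow> 'a::field vec set \<Rightarrow> nat" where
  "subspace_dim N W = vectorspace.dim class_ring (module_vec TYPE('a) N\<lparr>carrier := W\<rparr>)"

definition linear_code :: "nat \<Rightarrow> nat \<Rightarrow> 'a::field vec set \<Rightarrow> bool" where
  "linear_code N k C \<longleftrightarrow>
     VectorSpace.subspace class_ring C (module_vec TYPE('a) N) \<and> subspace_dim N C = k"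

text \<open>The row vector \<open>u A\<close> is written \<^term>\<open>transpose_mat A *\<^sub>v u\<close>. Vectors are indexed from \<open>0\<close>.\<close>

definition grl_codeword ::
  "nat \<Rightarrow> nat \<Rightarrow> nat \<Rightarrow> 'a::field vec \<Rightarrow> 'a vec \<Rightarrow> 'a mat \<Rightarrow> 'a poly \<Rightarrow> 'a vec" where
  "grl_codeword n s k a v A f =
     vec n (\<lambda>i. v $ i * poly f (a $ i))
     @\<^sub>v (transpose_mat A *\<^sub>v vec s (\<lambda>j. coeff f (k - s + j)))"

text \<open>As \<open>k \<ge> 1\<close> wherever this is used, \<open>degree f < k\<close> includes the zero polynomial.\<close>

definition grl_set ::
  "nat \<Rightarrow> nat \<Rightarrow> nat \<Rightarrow> 'a::field vec \<Rightarrow> 'a vec \<Rightarrow> 'a mat \<Rightarrow> 'a vec set" where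
  "grl_set n s k a v A = {grl_codeword n s k a v A f | f. degree f < k}"

definition is_grl_code :: "nat \<Rightarrow> nat \<Rightarrow> nat \<Rightarrow> 'a::field vec set \<Rightarrow> bool" where
  "is_grl_code n s k C \<longleftrightarrow> 1 \<le> s \<and> s \<le> k \<and> k \<le> n \<and>
     (\<exists>a v A. a \<in> carrier_vec n \<and> (\<forall>i<n. \<forall>j<n. i \<noteq> j \<longrightarrow> a $ i \<noteq> a $ j) \<and>
        v \<in> carrier_vec n \<and> (\<forall>i<n. v $ i \<noteq> 0) \<and>
        A \<in> carrier_mat s s \<and> invertible_mat A \<and>
        C = grl_set n s k a v A)"

end

theory Submission
  imports Defs "Jordan_Normal_Form.DL_Rank" "HOL-Number_Theory.Residues"
begin

text \<open>Let \<open>Q = p\<^sup>l\<close> and take as evaluation points the union of \<open>r1\<close> cosets of the group generated by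
  \<open>\<eta> = \<theta> ^ x2\<close>, with representatives \<open>\<xi> ^ i\<close> for \<open>\<xi> = \<theta> ^ x1\<close>, which lies in the field with \<open>Q\<close>
  elements. Weights in that field, constant on cosets, make \<open>\<Sum>\<^sub>i \<omega>\<^sub>i F(a\<^sub>i) = \<zeta> F(0)\<close> for every
  \<open>F\<close> of degree less than \<open>n\<close>. They are \<open>(Q + 1)\<close>-st powers, so they are realised by a multiplier
  vector \<open>v\<close>, and with the identity as the matrix, the Galois form of two codewords becomes
  \<open>\<zeta> f(0) g(0)^Q\<close> plus the Galois form of the top \<open>s\<close> coefficients. Rescaling the first \<open>t\<close> entries of
  \<open>v\<close> adds the terms \<open>(\<gamma> - 1) \<omega>\<^sub>i f(a\<^sub>i) g(a\<^sub>i)^Q\<close>. The hull then consists of the codewords of those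
  \<open>g\<close> of degree less than \<open>k - s\<close> that vanish at \<open>0\<close> and at the first \<open>t\<close> points, which has
  dimension \<open>k - s - 1 - t\<close>.\<close>

hide_const (open) up_ring.monom up_ring.coeff

section \<open>Codes parametrised by polynomials\<close>

lemma linear_code_injective_image:
  fixes T :: "'a::field vec \<Rightarrow> 'a vec"
  assumes carrier: "\<And>u. u \<in> carrier_vec m \<Longrightarrow> T u \<in> carrier_vec N"
    and add: "\<And>u w. u \<in> carrier_vec m \<Longrightarrow> w \<in> carrier_vec m \<Longrightarrow> T (u + w) = T u + T w"
    and smult: "\<And>c u. u \<in> carrier_vec m \<Longrightarrow> T (c \<cdot>\<^sub>v u) = c \<cdot>\<^sub>v T u"
    and inj: "\<And>u. u \<in> carrier_vec m \<Longrightarrow> T u = 0\<^sub>v N \<Longrightarrow> u = 0\<^sub>v m"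
  shows "linear_code N m (T ` carrier_vec m)"
proof -
  interpret V: vec_space "TYPE('a)" m .
  interpret W: vec_space "TYPE('a)" N .
  interpret lm: linear_map "class_ring :: 'a ring" "module_vec TYPE('a) m" "module_vec TYPE('a) N" T
    by unfold_locales (auto simp: LinearCombinations.module_hom_def module_vec_simps assms)
  have im: "lm.im = T ` carrier_vec m"
    unfolding lm.im_def by (simp add: module_vec_simps)
  have ker: "lm.kerT = {0\<^sub>v m}"
    using inj lm.f0_is_0 unfolding lm.ker_def by (auto simp: module_vec_simps)
  have "vectorspace.dim class_ring (V.vs {0\<^sub>v m}) = 0"
    using V.dim_zero_vs by (simp add: V.span_empty)
  with lm.rank_nullity[OF V.fin_dim] im ker
  show ?thesis
    using lm.imT_is_subspace by (simp add: linear_code_def subspace_dim_def V.dim_is_n)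
qed

definition poly_of_coeffs :: "'a::comm_monoid_add vec \<Rightarrow> 'a poly" where
  "poly_of_coeffs u = (\<Sum>i<dim_vec u. monom (u $ i) i)"

lemma coeff_poly_of_coeffs:
  "coeff (poly_of_coeffs u) i = (if i < dim_vec u then u $ i else 0)"
  by (simp add: poly_of_coeffs_def coeff_sum)

text \<open>Bounding the degree through vanishing coefficients, instead of
  \<open>degree f < m\<close>, leaves exactly the zero polynomial at \<open>m = 0\<close>. That case
  is needed for hulls of dimension \<open>0\<close>.\<close>

lemma poly_of_coeffs_image:
  "poly_of_coeffs ` carrier_vec m = {f. \<forall>i\<ge>m. coeff f i = 0}"
proof (intro equalityI subsetI)
  fix f :: "'a poly" assume "f \<in> {f. \<forall>i\<ge>m. coeff f i = 0}"
  then have "f = poly_of_coeffs (vec m (coeff f))"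
    by (intro poly_eqI) (auto simp: coeff_poly_of_coeffs)
  then show "f \<in> poly_of_coeffs ` carrier_vec m" by (metis imageI vec_carrier)
qed (auto simp: coeff_poly_of_coeffs)

lemma grl_codeword_add:
  assumes "A \<in> carrier_mat s s"
  shows "grl_codeword n s k a v A (f + g) = grl_codeword n s k a v A f + grl_codeword n s k a v A g"
proof -
  have "transpose_mat A *\<^sub>v vec s (\<lambda>j. coeff (f + g) (k - s + j)) =
    transpose_mat A *\<^sub>v vec s (\<lambda>j. coeff f (k - s + j)) + transpose_mat A *\<^sub>v vec s (\<lambda>j. coeff g (k - s + j))"
    using assms by (subst mult_add_distrib_mat_vec[symmetric, of _ s s]) (auto intro!: arg_cong2[of _ _ _ _ "(*\<^sub>v)"])
  then show ?thesis using assms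
    unfolding grl_codeword_def
    by (intro eq_vecI) (auto simp: algebra_simps)
qed

lemma grl_codeword_smult:
  assumes "A \<in> carrier_mat s s"
  shows "grl_codeword n s k a v A (Polynomial.smult c f) = c \<cdot>\<^sub>v grl_codeword n s k a v A f"
proof -
  have "transpose_mat A *\<^sub>v vec s (\<lambda>j. coeff (Polynomial.smult c f) (k - s + j)) =
    c \<cdot>\<^sub>v (transpose_mat A *\<^sub>v vec s (\<lambda>j. coeff f (k - s + j)))"
    using assms by (subst mult_mat_vec[symmetric, of _ s s]) (auto intro!: arg_cong2[of _ _ _ _ "(*\<^sub>v)"])
  then show ?thesis using assms
    unfolding grl_codeword_def
    by (intro eq_vecI) (auto simp: algebra_simps)
qed

lemma grl_codeword_carrier:
  "A \<in> carrier_mat s s \<Longrightarrow> grl_codeword n s k a v A f \<in> carrier_vec (n + s)"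
  unfolding grl_codeword_def by (intro append_carrier_vec) auto

text \<open>The first \<open>n\<close> coordinates already decide: a polynomial of degree less than
  \<open>n\<close> with \<open>n\<close> distinct roots is zero.\<close>

lemma grl_codeword_eq_0D:
  fixes f :: "'a::field poly"
  assumes zero: "grl_codeword n s k a v A f = 0\<^sub>v (n + s)" and A: "A \<in> carrier_mat s s"
    and a: "inj_on (($) a) {..<n}" and v: "\<And>i. i < n \<Longrightarrow> v $ i \<noteq> 0" and deg: "degree f < n"
  shows "f = 0"
proof (rule poly_eqI_degree[of "($) a ` {..<n}"])
  fix x assume "x \<in> ($) a ` {..<n}"
  then obtain i where i: "i < n" "x = a $ i" by auto
  then have "v $ i * poly f (a $ i) = grl_codeword n s k a v A f $ i"
    using A by (simp add: grl_codeword_def)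
  also have "\<dots> = 0" using i zero by simp
  finally show "poly f x = poly 0 x" using i v by simp
qed (use deg a in \<open>auto simp: card_image\<close>)

text \<open>For nonzero \<open>f\<close> the product \<open>w * f\<close> is nonzero of degree less
  than \<open>n\<close>, so encoding stays injective. The case \<open>w = 1\<close> serves for the
  whole code, a product of linear factors for the hull.\<close>

lemma linear_code_grl_multiples:
  fixes w :: "'a::field poly"
  assumes A: "A \<in> carrier_mat s s"
    and a: "inj_on (($) a) {..<n}" and v: "\<And>i. i < n \<Longrightarrow> v $ i \<noteq> 0"
    and w: "w \<noteq> 0" and deg: "degree w + m \<le> n"
  shows "linear_code (n + s) m ((\<lambda>f. grl_codeword n s k a v A (w * f)) ` {f. \<forall>i\<ge>m. coeff f i = 0})"
proof -
  have "linear_code (n + s) m ((\<lambda>u. grl_codeword n s k a v A (w * poly_of_coeffs u)) ` carrier_vec m)"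
  proof (rule linear_code_injective_image)
    fix u u' :: "'a vec" assume u: "u \<in> carrier_vec m" "u' \<in> carrier_vec m"
    have "poly_of_coeffs (u + u') = poly_of_coeffs u + poly_of_coeffs u'"
      using u by (intro poly_eqI) (auto simp: coeff_poly_of_coeffs)
    then show "grl_codeword n s k a v A (w * poly_of_coeffs (u + u')) =
        grl_codeword n s k a v A (w * poly_of_coeffs u) + grl_codeword n s k a v A (w * poly_of_coeffs u')"
      by (simp add: distrib_left grl_codeword_add[OF A])
  next
    fix c and u :: "'a vec" assume u: "u \<in> carrier_vec m"
    have "poly_of_coeffs (c \<cdot>\<^sub>v u) = Polynomial.smult c (poly_of_coeffs u)"
      using u by (intro poly_eqI) (auto simp: coeff_poly_of_coeffs)
    then show "grl_codeword n s k a v A (w * poly_of_coeffs (c \<cdot>\<^sub>v u)) =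
        c \<cdot>\<^sub>v grl_codeword n s k a v A (w * poly_of_coeffs u)"
      by (simp add: grl_codeword_smult[OF A])
  next
    fix u :: "'a vec"
    assume u: "u \<in> carrier_vec m" and 0: "grl_codeword n s k a v A (w * poly_of_coeffs u) = 0\<^sub>v (n + s)"
    have "poly_of_coeffs u = 0"
    proof (rule ccontr)
      assume ne: "poly_of_coeffs u \<noteq> 0"
      then have "coeff (poly_of_coeffs u) (degree (poly_of_coeffs u)) \<noteq> 0" by simp
      then have "degree (poly_of_coeffs u) < m"
        using u by (auto simp: coeff_poly_of_coeffs split: if_splits)
      then have "degree (w * poly_of_coeffs u) < n"
        using deg w ne by (simp add: degree_mult_eq)
      from grl_codeword_eq_0D[OF 0 A a v this] ne w show False by simp
    qed
    then have "u $ i = 0" if "i < m" for i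
      using that u coeff_poly_of_coeffs[of u i] by simp
    then show "u = 0\<^sub>v m" using u by (intro eq_vecI) auto
  qed (rule grl_codeword_carrier[OF A])
  then show ?thesis by (simp flip: poly_of_coeffs_image add: image_image)
qed

lemma coeff_eq_0_iff_degree_less:
  assumes "m > 0"
  shows "(\<forall>i\<ge>m. coeff f i = 0) \<longleftrightarrow> degree f < m"
proof
  assume *: "\<forall>i\<ge>m. coeff f i = 0"
  show "degree f < m"
  proof (rule ccontr)
    assume "\<not> degree f < m"
    then have "coeff f (degree f) = 0" using * by simp
    then have "f = 0" by simp
    with \<open>\<not> degree f < m\<close> assms show False by simp
  qed
qed (auto intro: coeff_eq_0)

section \<open>Weighted sums over cosets\<close>

lemma lagrange_weighted_sum:
  fixes b :: "nat \<Rightarrow> 'a::field"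
  assumes inj: "inj_on b {..<r}" and deg: "degree f + 2 \<le> r"
  shows "(\<Sum>i<r. poly f (b i) / (\<Prod>j\<in>{..<r} - {i}. b i - b j)) = 0"
proof -
  define c where "c i = poly f (b i) / (\<Prod>j\<in>{..<r} - {i}. b i - b j)" for i
  define L where "L i = (\<Prod>j\<in>{..<r} - {i}. [:- b j, 1:])" for i
  have degL: "degree (L i) = r - 1" and lcL: "coeff (L i) (r - 1) = 1" if "i < r" for i
  proof -
    show *: "degree (L i) = r - 1"
      using that by (simp add: L_def degree_prod_eq_sum_degree)
    have "lead_coeff (L i) = 1" unfolding L_def lead_coeff_prod by simp
    then show "coeff (L i) (r - 1) = 1" by (simp add: *)
  qed
  \<comment> \<open>Lagrange interpolation at the \<open>r\<close> nodes. Each \<open>L i\<close> is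
    monic of degree \<open>r - 1\<close>, while \<open>f\<close> has degree at most
    \<open>r - 2\<close>, so comparing coefficients at \<open>r - 1\<close> gives the claim.\<close>
  have "f = (\<Sum>i<r. Polynomial.smult (c i) (L i))"
  proof (rule poly_eqI_degree[of "b ` {..<r}"])
    fix x assume "x \<in> b ` {..<r}"
    then obtain m where m: "m < r" "x = b m" by auto
    have "poly (\<Sum>i<r. Polynomial.smult (c i) (L i)) x = (\<Sum>i<r. c i * poly (L i) (b m))"
      by (simp add: poly_sum m)
    also have "\<dots> = (\<Sum>i<r. if i = m then c m * poly (L m) (b m) else 0)"
      using m by (intro sum.cong) (auto simp: L_def poly_prod)
    also have "\<dots> = c m * poly (L m) (b m)" using m by simp
    also have "\<dots> = poly f x"
    proof -
      have "(\<Prod>j\<in>{..<r} - {m}. b m - b j) \<noteq> 0"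
        using inj m by (auto simp: inj_on_def)
      then show ?thesis by (simp add: c_def L_def poly_prod m)
    qed
    finally show "poly f x = poly (\<Sum>i<r. Polynomial.smult (c i) (L i)) x" by simp
  next
    have "degree (\<Sum>i<r. Polynomial.smult (c i) (L i)) \<le> r - 1"
      using degL by (intro degree_sum_le) (auto intro: order.trans[OF degree_smult_le])
    then show "degree (\<Sum>i<r. Polynomial.smult (c i) (L i)) < card (b ` {..<r})"
      using inj deg by (simp add: card_image)
  qed (use inj deg in \<open>simp add: card_image\<close>)
  then have "coeff f (r - 1) = (\<Sum>i<r. c i * coeff (L i) (r - 1))"
    by (metis (mono_tags, lifting) coeff_smult coeff_sum sum.cong)
  also have "\<dots> = (\<Sum>i<r. c i)" using lcL by simp
  finally show ?thesis using deg by (simp add: c_def coeff_eq_0)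
qed

text \<open>The \<open>m\<close>-th weighted power sum splits into a sum over coset representatives
  times a geometric sum in \<open>\<eta> ^ m\<close>. For \<open>0 < m < r * N\<close> the geometric
  factor vanishes unless \<open>N\<close> divides \<open>m\<close>, and then the other factor
  vanishes by Lagrange. Only the constant term of \<open>F\<close> survives.\<close>

lemma coset_power_sums:
  fixes \<xi> \<eta> :: "'a::field"
  assumes N: "N > 0" "\<eta> ^ N = 1" "\<And>j. 0 < j \<Longrightarrow> j < N \<Longrightarrow> \<eta> ^ j \<noteq> 1"
    and \<xi>: "\<xi> \<noteq> 0" and b: "\<And>i. b i = \<xi> ^ (i * N)" and inj: "inj_on b {..<r}"
    and w: "\<And>i. w i = inverse (b i * (\<Prod>j\<in>{..<r} - {i}. b i - b j))"
    and deg: "degree F < r * N"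
  shows "(\<Sum>i<r * N. w (i div N) * poly F (\<xi> ^ (i div N) * \<eta> ^ (i mod N))) =
    (\<Sum>i<r * N. w (i div N)) * poly F 0"
proof -
  define a where "a i = \<xi> ^ (i div N) * \<eta> ^ (i mod N)" for i
  define S where "S m = (\<Sum>i<r * N. w (i div N) * a i ^ m)" for m
  have S_eq: "S m = (\<Sum>i<r. w i * \<xi> ^ (i * m) * (\<Sum>j<N. (\<eta> ^ m) ^ j))" for m
  proof -
    have "S m = (\<Sum>i<r. \<Sum>j\<in>{i * N..<i * N + N}. w (j div N) * a j ^ m)"
      by (simp add: S_def sum.nat_group)
    also have "\<dots> = (\<Sum>i<r. \<Sum>j<N. w i * (\<xi> ^ i * \<eta> ^ j) ^ m)"
    proof (rule sum.cong[OF refl])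
      fix i
      have "(\<Sum>j\<in>{i * N..<i * N + N}. w (j div N) * a j ^ m) =
          (\<Sum>j\<in>{0 + i * N..<N + i * N}. w (j div N) * a j ^ m)"
        by (simp add: add.commute)
      also have "\<dots> = (\<Sum>j<N. w i * (\<xi> ^ i * \<eta> ^ j) ^ m)"
        unfolding sum.shift_bounds_nat_ivl
        by (intro sum.cong) (auto simp: a_def)
      finally show "(\<Sum>j\<in>{i * N..<i * N + N}. w (j div N) * a j ^ m) =
          (\<Sum>j<N. w i * (\<xi> ^ i * \<eta> ^ j) ^ m)" .
    qed
    also have "\<dots> = (\<Sum>i<r. w i * \<xi> ^ (i * m) * (\<Sum>j<N. (\<eta> ^ m) ^ j))"
      unfolding sum_distrib_left
      by (intro sum.cong refl) (simp add: power_mult_distrib flip: power_mult add: mult_ac)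
    finally show ?thesis .
  qed
  have S_0: "S m = 0" if m: "0 < m" "m < r * N" for m
  proof (cases "N dvd m")
    case False
    have "\<eta> ^ m = (\<eta> ^ N) ^ (m div N) * \<eta> ^ (m mod N)"
      by (simp flip: power_mult power_add)
    also have "\<dots> \<noteq> 1" using N False by (simp add: mod_greater_zero_iff_not_dvd)
    finally have "\<eta> ^ m \<noteq> 1" .
    moreover have "(\<eta> ^ m) ^ N = 1" using N by (metis mult.commute power_mult power_one)
    ultimately show ?thesis by (simp add: S_eq geometric_sum)
  next
    case True
    then obtain c where c: "m = N * c" by auto
    with m have "c > 0" "c < r" by (auto simp: mult.commute)
    \<comment> \<open>The factor \<open>inverse (b i)\<close> in the weight lowers the exponent
      \<open>c\<close> to \<open>c - 1\<close>, which is at most \<open>r - 2\<close>, the range of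
      the Lagrange identity.\<close>
    have "w i * \<xi> ^ (i * m) = poly (Polynomial.monom 1 (c - 1)) (b i) / (\<Prod>j\<in>{..<r} - {i}. b i - b j)" for i
    proof -
      have "\<xi> ^ (i * m) = b i ^ c" by (simp only: b c mult.assoc power_mult)
      also have "\<dots> = b i * b i ^ (c - 1)" using \<open>c > 0\<close> by (cases c) simp_all
      finally have "\<xi> ^ (i * m) = b i * b i ^ (c - 1)" .
      moreover have "b i \<noteq> 0" using \<xi> by (simp add: b)
      ultimately show ?thesis by (simp add: w poly_monom field_simps)
    qed
    then have "S m = (\<Sum>i<r. poly (Polynomial.monom 1 (c - 1)) (b i) / (\<Prod>j\<in>{..<r} - {i}. b i - b j))
        * (\<Sum>j<N. (\<eta> ^ m) ^ j)"
      by (simp add: S_eq sum_distrib_right)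
    also have "\<dots> = 0"
      using lagrange_weighted_sum[OF inj, of "Polynomial.monom 1 (c - 1)"] \<open>c > 0\<close> \<open>c < r\<close>
      by (simp add: degree_monom_eq)
    finally show ?thesis .
  qed
  have "(\<Sum>i<r * N. w (i div N) * poly F (a i)) = (\<Sum>i<r * N. \<Sum>m\<le>degree F. coeff F m * (w (i div N) * a i ^ m))"
    by (simp add: poly_altdef sum_distrib_left mult_ac)
  also have "\<dots> = (\<Sum>m\<le>degree F. coeff F m * S m)"
    by (subst sum.swap) (simp add: S_def sum_distrib_left)
  also have "\<dots> = (\<Sum>m\<in>{0}. coeff F m * S m)"
    using S_0 deg by (intro sum.mono_neutral_right) auto
  also have "\<dots> = (\<Sum>i<r * N. w (i div N)) * poly F 0"
    by (simp add: S_def poly_0_coeff_0)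
  finally show ?thesis by (simp add: a_def)
qed

section \<open>Generators, Frobenius and orders in finite fields\<close>

lemma finite_field_generator:
  obtains \<theta> :: "'a::{field,finite}" where "\<theta> \<noteq> 0" "\<And>x. x \<noteq> 0 \<Longrightarrow> \<exists>i. x = \<theta> ^ i"
    "\<And>m. \<theta> ^ m = 1 \<longleftrightarrow> (CARD('a) - 1) dvd m"
proof -
  obtain \<theta> :: 'a where "\<theta> \<in> carrier (mult_of class_ring)"
      "carrier (mult_of class_ring) = {\<theta> [^]\<^bsub>class_ring\<^esub> i | i::nat. i \<in> UNIV}"
    using field.finite_field_mult_group_has_gen[OF class_field[where 'a = 'a]] by auto
  then have \<theta>: "\<theta> \<noteq> 0" "UNIV - {0} = range (\<lambda>i. \<theta> ^ i)"
    by (auto simp: class_ring_simps)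
  have "\<not> inj (\<lambda>i::nat. \<theta> ^ i)"
    using finite_imageD[of "\<lambda>i::nat. \<theta> ^ i" UNIV] by auto
  then obtain i j where "i < j" "\<theta> ^ i = \<theta> ^ j"
    using linorder_injI[of "\<lambda>i::nat. \<theta> ^ i"] by blast
  then have ex: "\<exists>d>0. \<theta> ^ d = 1"
    using \<theta>(1) power_diff[OF \<theta>(1), of i j] by (intro exI[of _ "j - i"]) simp
  define d where "d = (LEAST d. d > 0 \<and> \<theta> ^ d = 1)"
  have d: "d > 0" "\<theta> ^ d = 1" using LeastI_ex[OF ex] by (auto simp: d_def)
  have least: "\<theta> ^ m \<noteq> 1" if "0 < m" "m < d" for m
    using that not_less_Least[of m "\<lambda>d. d > 0 \<and> \<theta> ^ d = 1"] by (auto simp: d_def)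
  have mod: "\<theta> ^ m = \<theta> ^ (m mod d)" for m
  proof -
    have "\<theta> ^ m = (\<theta> ^ d) ^ (m div d) * \<theta> ^ (m mod d)"
      by (simp flip: power_mult power_add)
    then show ?thesis using d by simp
  qed
  have dvd: "\<theta> ^ m = 1 \<longleftrightarrow> d dvd m" for m
    using mod[of m] least[of "m mod d"] d by (cases "m mod d = 0") (auto simp: dvd_eq_mod_eq_0)
  \<comment> \<open>The powers below the order \<open>d\<close> are distinct and exhaust the nonzero
    elements, which forces \<open>d\<close> to be the field size minus one.\<close>
  have "UNIV - {0} = (\<lambda>i. \<theta> ^ i) ` {..<d}"
    unfolding \<theta>(2)
  proof (intro equalityI subsetI)
    fix x assume "x \<in> range (\<lambda>i. \<theta> ^ i)"
    then obtain m where "x = \<theta> ^ m" by auto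
    then show "x \<in> (\<lambda>i. \<theta> ^ i) ` {..<d}" using mod[of m] d(1) by (intro image_eqI[of _ _ "m mod d"]) auto
  qed auto
  moreover have "inj_on (\<lambda>i. \<theta> ^ i) {..<d}"
  proof (rule linorder_inj_onI)
    fix i j assume "i < j" "i \<in> {..<d}" "j \<in> {..<d}"
    then show "\<theta> ^ i \<noteq> \<theta> ^ j"
      using least[of "j - i"] power_diff[OF \<theta>(1), of i j] \<theta>(1) by (auto simp: less_imp_diff_less)
  qed auto
  ultimately have "card (UNIV - {0::'a}) = d" by (simp add: card_image)
  then have "d = CARD('a) - 1" by (simp add: card_Diff_subset)
  moreover have "\<exists>i. x = \<theta> ^ i" if "x \<noteq> 0" for x
    using that \<theta>(2) by blast
  ultimately show thesis using that[of \<theta>] \<theta>(1) dvd by simp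
qed

text \<open>The characteristic divides \<open>p ^ e\<close>, hence equals \<open>p\<close>. Applying
  additivity to \<open>(x - y) + y\<close> avoids discussing the sign of
  \<open>(-1) ^ (p ^ l)\<close>.\<close>

lemma frobenius_diff:
  fixes x y :: "'a::{field,finite}"
  assumes "prime p" and "CARD('a) = p ^ e"
  shows "(x - y) ^ (p ^ l) = x ^ (p ^ l) - y ^ (p ^ l)"
proof -
  have "prime CHAR('a)" by (simp add: finite_imp_CHAR_pos prime_CHAR_semidom)
  moreover have "CHAR('a) dvd p ^ e" using CHAR_dvd_CARD[where 'a = 'a] assms(2) by simp
  ultimately have "CHAR('a) = p" using assms(1) prime_dvd_power primes_dvd_imp_eq by blast
  then have "((x - y) + y) ^ (p ^ l) = (x - y) ^ (p ^ l) + y ^ (p ^ l)"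
    using \<open>prime CHAR('a)\<close> by (intro freshmans_dream') auto
  then show ?thesis by (simp add: algebra_simps)
qed

text \<open>With \<open>c\<close> the order of a generator \<open>\<theta>\<close>, this identifies
  the order of \<open>\<theta> ^ x\<close> as \<open>c div gcd x c\<close>.\<close>

lemma dvd_mult_iff_div_gcd:
  fixes c x j :: nat
  assumes "c > 0"
  shows "c dvd x * j \<longleftrightarrow> c div gcd x c dvd j"
proof -
  define g where "g = gcd x c"
  have "g > 0" using assms by (simp add: g_def)
  then have "gcd x c \<noteq> 0" by (simp add: g_def)
  then obtain c' x' where cx: "c = c' * g" "x = x' * g" "coprime x' c'"
    unfolding g_def using gcd_coprime_exists[of x c] by blast
  have "c dvd x * j \<longleftrightarrow> c' * g dvd (x' * j) * g"
    by (subst cx(1), subst cx(2)) (simp only: ac_simps)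
  also have "\<dots> \<longleftrightarrow> c' dvd j"
    using cx(3) \<open>g > 0\<close> by (simp add: coprime_dvd_mult_right_iff coprime_commute)
  also have "c' = c div gcd x c"
    using cx(1) \<open>g > 0\<close> unfolding g_def[symmetric] by (metis div_mult_self_is_m)
  finally show ?thesis .
qed

text \<open>If \<open>d\<close> divides both quotients, then \<open>d\<close> times the lcm of the
  two gcds divides \<open>c\<close>. By distributivity that lcm is
  \<open>gcd (lcm x y) c = c\<close>, so \<open>d\<close> is a unit.\<close>

lemma coprime_div_gcd:
  fixes c x y :: nat
  assumes "c > 0" and "c dvd lcm x y"
  shows "coprime (c div gcd x c) (c div gcd y c)"
proof (rule coprimeI)
  fix d assume d: "d dvd c div gcd x c" "d dvd c div gcd y c"
  have "gcd x c * d dvd c" "gcd y c * d dvd c"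
    using mult_dvd_mono[OF dvd_refl d(1), of "gcd x c"] mult_dvd_mono[OF dvd_refl d(2), of "gcd y c"]
    by simp_all
  then have "lcm (gcd x c) (gcd y c) * d dvd c"
    using lcm_least[of "gcd x c * d" c "gcd y c * d"] by (simp add: lcm_mult_right lcm.commute[of "gcd y c"])
  moreover have "lcm (gcd x c) (gcd y c) = gcd (lcm x y) c"
    using gcd_lcm_distrib[of c x y] by (simp only: gcd.commute)
  moreover have "gcd (lcm x y) c = c" using assms(2) by (simp add: gcd_proj2_if_dvd)
  ultimately have "c * d dvd c" by simp
  then show "is_unit d" using assms(1) by simp
qed

section \<open>The Galois hull\<close>

lemma prod_linear_factors_dvd:
  fixes g :: "'a::idom poly"
  assumes "finite I" and "inj_on b I" and "\<And>i. i \<in> I \<Longrightarrow> poly g (b i) = 0"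
  shows "(\<Prod>i\<in>I. [:- b i, 1:]) dvd g"
  using assms
proof (induction I rule: finite_induct)
  case (insert x I)
  then obtain u where u: "g = (\<Prod>i\<in>I. [:- b i, 1:]) * u" by auto
  have "poly (\<Prod>i\<in>I. [:- b i, 1:]) (b x) \<noteq> 0"
    using insert.hyps insert.prems(1) by (auto simp: poly_prod)
  moreover have "poly g (b x) = 0" using insert.prems by simp
  ultimately have "[:- b x, 1:] dvd u" by (simp add: u poly_eq_0_iff_dvd)
  then have "[:- b x, 1:] * (\<Prod>i\<in>I. [:- b i, 1:]) dvd u * (\<Prod>i\<in>I. [:- b i, 1:])"
    by (rule mult_dvd_mono) simp
  moreover have "(\<Prod>i\<in>insert x I. [:- b i, 1:]) = [:- b x, 1:] * (\<Prod>i\<in>I. [:- b i, 1:])"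
    using insert.hyps by (rule prod.insert)
  moreover have "g = u * (\<Prod>i\<in>I. [:- b i, 1:])"
    unfolding u by (rule mult.commute)
  ultimately show ?case by argo
qed simp

lemma sum_lessThan_add:
  "(\<Sum>i<n + s. f i) = (\<Sum>i<n. f i) + (\<Sum>j<s. f (n + j))"
  for f :: "nat \<Rightarrow> 'a::comm_monoid_add"
  by (induction s) (simp_all add: ac_simps)

text \<open>Collecting both arguments into the single polynomial \<open>f * g ^ (p ^ l)\<close>
  makes the evaluation part a weighted sum to which the coset identity applies.\<close>

lemma galois_inner_grl_codeword:
  "galois_inner p l (grl_codeword n s k a v (1\<^sub>m s) f) (grl_codeword n s k a v (1\<^sub>m s) g) =
    (\<Sum>i<n. (v $ i) ^ (p ^ l + 1) * poly (f * g ^ (p ^ l)) (a $ i)) +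
    (\<Sum>j<s. coeff f (k - s + j) * coeff g (k - s + j) ^ (p ^ l))"
  by (simp add: galois_inner_def grl_codeword_def sum_lessThan_add power_mult_distrib mult_ac)

text \<open>The form is diagonal, with nonzero weights, in \<open>t + 1\<close> point evaluations
  and \<open>s\<close> top coefficients. Test polynomials isolate each of them, so orthogonality
  makes all of them vanish on \<open>g\<close>.\<close>

lemma grl_hull_dimension:
  fixes a v :: "'a::field vec"
  assumes a: "inj_on (($) a) {..<n}" "\<And>i. i < n \<Longrightarrow> a $ i \<noteq> 0"
    and v: "\<And>i. i < n \<Longrightarrow> v $ i \<noteq> 0"
    and v_norm: "\<And>i. i < n \<Longrightarrow> (v $ i) ^ (p ^ l + 1) = \<omega> i * (if i < t then \<gamma> else 1)"
    and sums: "\<And>F. degree F < n \<Longrightarrow> (\<Sum>i<n. \<omega> i * poly F (a $ i)) = \<zeta> * poly F 0"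
    and \<gamma>: "\<gamma> \<noteq> 1" and p: "p > 0"
    and k: "h + t + s + 1 = k" "(p ^ l + 1) * (k - 1) < n"
  shows "subspace_dim (n + s) (galois_hull p l (n + s) (grl_set n s k a v (1\<^sub>m s))) = h"
proof -
  define cw where "cw = grl_codeword n s k a v (1\<^sub>m s)"
  define Q where "Q = p ^ l"
  \<comment> \<open>Index \<open>0\<close> is the point \<open>0\<close> with weight
    \<open>\<zeta>\<close>; index \<open>Suc i\<close> is the evaluation point \<open>a $ i\<close>
    with the excess weight left by rescaling. Both kinds of term are then treated alike.\<close>
  define b where "b i = (case i of 0 \<Rightarrow> 0 | Suc i \<Rightarrow> a $ i)" for i
  define \<kappa> where "\<kappa> i = (case i of 0 \<Rightarrow> \<zeta> | Suc i \<Rightarrow> \<omega> i * (\<gamma> - 1))" for i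
  define w where "w = (\<Prod>i<Suc t. [:- b i, 1:])"
  have Q: "Q > 0" using p by (simp add: Q_def)
  have "k - 1 < n" using k(2) by (simp add: Q_def[symmetric])
  then have tn: "t < n" "k \<le> n" "n > 0" using k(1) by auto
  have \<omega>: "\<omega> i \<noteq> 0" if "i < n" for i
    using v[OF that] v_norm[OF that] by auto
  \<comment> \<open>Otherwise the sum identity fails for the polynomial of degree
    \<open>n - 1\<close> vanishing at every evaluation point except \<open>a $ 0\<close>.\<close>
  have \<zeta>: "\<zeta> \<noteq> 0"
  proof
    assume 0: "\<zeta> = 0"
    define F where "F = (\<Prod>i\<in>{1..<n}. [:- (a $ i), 1:])"
    have "degree F < n" using tn by (simp add: F_def degree_prod_eq_sum_degree)
    then have "0 = (\<Sum>i<n. \<omega> i * poly F (a $ i))" using sums 0 by simp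
    also have "\<dots> = (\<Sum>i\<in>{0}. \<omega> i * poly F (a $ i))"
      using tn by (intro sum.mono_neutral_right) (auto simp: F_def poly_prod)
    also have "\<dots> = \<omega> 0 * (\<Prod>i\<in>{1..<n}. a $ 0 - a $ i)" by (simp add: F_def poly_prod)
    also have "\<dots> \<noteq> 0" using \<omega>[of 0] a(1) tn by (fastforce simp: inj_on_def)
    finally show False by simp
  qed
  have inj_b: "inj_on b {..<Suc t}"
  proof (rule linorder_inj_onI)
    fix i j assume *: "i < j" "i \<in> {..<Suc t}" "j \<in> {..<Suc t}"
    then obtain j' where j': "j = Suc j'" "j' < n" using tn by (cases j) auto
    show "b i \<noteq> b j"
      using * j' tn a(2) inj_onD[OF a(1), of "i - 1" j'] by (cases i) (auto simp: b_def)
  qed auto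
  have \<kappa>: "\<kappa> i \<noteq> 0" if "i < Suc t" for i
    using that tn \<zeta> \<omega> \<gamma> by (cases i) (auto simp: \<kappa>_def)
  have inner: "galois_inner p l (cw f) (cw g) =
      (\<Sum>i<Suc t. \<kappa> i * poly f (b i) * poly g (b i) ^ Q) +
      (\<Sum>j<s. coeff f (k - s + j) * coeff g (k - s + j) ^ Q)"
    if "degree f < k" "degree g < k" for f g
  proof -
    define F where "F = f * g ^ Q"
    \<comment> \<open>The bound on \<open>k\<close> keeps \<open>F\<close> within the range of the
      sum identity.\<close>
    have "degree F \<le> degree f + Q * degree g"
      unfolding F_def by (metis add_left_mono degree_mult_le degree_power_le le_trans mult.commute)
    also have "\<dots> \<le> (k - 1) + Q * (k - 1)"
      using that by (intro add_mono mult_left_mono) auto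
    also have "\<dots> < n" using k(2) by (simp add: Q_def algebra_simps)
    finally have degF: "degree F < n" .
    have "(\<Sum>i<n. (v $ i) ^ (p ^ l + 1) * poly F (a $ i)) =
        (\<Sum>i<n. \<omega> i * poly F (a $ i) + (if i < t then \<omega> i * (\<gamma> - 1) * poly F (a $ i) else 0))"
      using v_norm by (intro sum.cong) (auto simp: algebra_simps)
    also have "\<dots> = \<zeta> * poly F 0 + (\<Sum>i<n. if i < t then \<omega> i * (\<gamma> - 1) * poly F (a $ i) else 0)"
      by (simp add: sum.distrib sums degF)
    also have "(\<Sum>i<n. if i < t then \<omega> i * (\<gamma> - 1) * poly F (a $ i) else 0) =
        (\<Sum>i<t. \<omega> i * (\<gamma> - 1) * poly F (a $ i))"
      using tn by (intro sum.mono_neutral_cong_right) auto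
    also have "\<zeta> * poly F 0 + \<dots> = (\<Sum>i<Suc t. \<kappa> i * poly F (b i))"
      by (simp add: sum.lessThan_Suc_shift b_def \<kappa>_def del: sum.lessThan_Suc)
    finally show ?thesis
      unfolding cw_def galois_inner_grl_codeword F_def[symmetric]
      by (simp add: F_def Q_def mult_ac del: sum.lessThan_Suc)
  qed
  have "galois_hull p l (n + s) (grl_set n s k a v (1\<^sub>m s)) =
      (\<lambda>f. cw (w * f)) ` {f. \<forall>i\<ge>h. coeff f i = 0}"
  proof (intro equalityI subsetI)
    fix x assume "x \<in> galois_hull p l (n + s) (grl_set n s k a v (1\<^sub>m s))"
    then obtain g where g: "x = cw g" "degree g < k"
      and orth: "\<And>f. degree f < k \<Longrightarrow> galois_inner p l (cw f) (cw g) = 0"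
      by (auto simp: galois_hull_def galois_dual_def grl_set_def cw_def)
    have root: "poly g (b i) = 0" if i: "i < Suc t" for i
    proof -
      \<comment> \<open>This isolates node \<open>b i\<close>. Its degree \<open>t\<close> is below
        \<open>k - s\<close>, so the top coefficients contribute nothing.\<close>
      define f where "f = (\<Prod>j\<in>{..<Suc t} - {i}. [:- b j, 1:])"
      have f: "degree f = t" using i by (simp add: f_def degree_prod_eq_sum_degree del: lessThan_Suc)
      have "0 = (\<Sum>j<Suc t. \<kappa> j * poly f (b j) * poly g (b j) ^ Q)"
        using orth[of f] inner[of f g] g(2) f k(1) by (simp add: coeff_eq_0 del: sum.lessThan_Suc)
      also have "\<dots> = (\<Sum>j\<in>{i}. \<kappa> j * poly f (b j) * poly g (b j) ^ Q)"
        using i by (intro sum.mono_neutral_right) (auto simp: f_def poly_prod)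
      also have "\<dots> = \<kappa> i * (\<Prod>j\<in>{..<Suc t} - {i}. b i - b j) * poly g (b i) ^ Q"
        by (simp add: f_def poly_prod)
      finally have "\<kappa> i * (\<Prod>j\<in>{..<Suc t} - {i}. b i - b j) * poly g (b i) ^ Q = 0" by simp
      moreover have "(\<Prod>j\<in>{..<Suc t} - {i}. b i - b j) \<noteq> 0"
        using inj_b i by (auto simp: inj_on_def)
      ultimately show ?thesis using \<kappa>[OF i] by auto
    qed
    have top: "coeff g (k - s + j) = 0" if j: "j < s" for j
    proof -
      \<comment> \<open>The roots just found remove the evaluation part, so a monomial isolates one
        top coefficient of \<open>g\<close>.\<close>
      have "0 = (\<Sum>j'<s. coeff (Polynomial.monom 1 (k - s + j)) (k - s + j') * coeff g (k - s + j') ^ Q)"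
        using orth[of "Polynomial.monom 1 (k - s + j)"] inner[of "Polynomial.monom 1 (k - s + j)" g] g(2) j k(1) root Q
        by (simp add: degree_monom_eq del: sum.lessThan_Suc coeff_monom)
      also have "\<dots> = (\<Sum>j'<s. if j' = j then coeff g (k - s + j) ^ Q else 0)"
        by (intro sum.cong) auto
      finally show ?thesis using j by simp
    qed
    obtain f where f: "g = w * f"
      using prod_linear_factors_dvd[OF _ inj_b, of g] root by (auto simp: w_def)
    have "coeff g i = 0" if "i \<ge> k - s" for i
      using top[of "i - (k - s)"] that g(2) by (cases "i < k") (auto intro: coeff_eq_0)
    then have "degree g < k - s" using coeff_eq_0_iff_degree_less[of "k - s" g] k(1) by auto
    moreover have "degree w = Suc t" "w \<noteq> 0"
      by (auto simp: w_def degree_prod_eq_sum_degree simp del: prod.lessThan_Suc)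
    \<comment> \<open>Here \<open>k - s = h + t + 1\<close> and \<open>w\<close> has degree
      \<open>t + 1\<close>. The zero cofactor is separate because its degree is not below
      \<open>h = 0\<close>.\<close>
    ultimately have "f = 0 \<or> degree f < h"
      using f k(1) by (cases "f = 0") (auto simp: degree_mult_eq)
    then have "\<forall>i\<ge>h. coeff f i = 0" by (auto intro: coeff_eq_0)
    then show "x \<in> (\<lambda>f. cw (w * f)) ` {f. \<forall>i\<ge>h. coeff f i = 0}" using g f by auto
  next
    fix x assume "x \<in> (\<lambda>f. cw (w * f)) ` {f. \<forall>i\<ge>h. coeff f i = 0}"
    then obtain u where u: "\<forall>i\<ge>h. coeff u i = 0" "x = cw (w * u)" by auto
    define g where "g = w * u"
    have "degree w = Suc t" by (simp add: w_def degree_prod_eq_sum_degree del: prod.lessThan_Suc)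
    have "u = 0 \<or> degree u < h" using u(1) by (metis leI leading_coeff_0_iff)
    then have degg: "degree g < k - s"
      using degree_mult_le[of w u] \<open>degree w = Suc t\<close> k(1) by (auto simp: g_def)
    have root: "poly g (b i) = 0" if "i < Suc t" for i
      using that by (auto simp: g_def w_def poly_prod simp del: prod.lessThan_Suc)
    have "galois_inner p l (cw f) (cw g) = 0" if "degree f < k" for f
      using inner[OF that, of g] degg root Q by (simp add: coeff_eq_0 del: sum.lessThan_Suc)
    moreover have "cw g \<in> carrier_vec (n + s)" by (simp add: cw_def grl_codeword_carrier)
    ultimately show "x \<in> galois_hull p l (n + s) (grl_set n s k a v (1\<^sub>m s))"
      using degg u(2) by (auto simp: galois_hull_def galois_dual_def grl_set_def cw_def g_def)
  qed
  moreover have "linear_code (n + s) h ((\<lambda>f. cw (w * f)) ` {f. \<forall>i\<ge>h. coeff f i = 0})"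
    unfolding cw_def
  proof (rule linear_code_grl_multiples[OF _ a(1) v])
    show "w \<noteq> 0" by (simp add: w_def del: prod.lessThan_Suc)
    show "degree w + h \<le> n"
      using k(1) tn by (simp add: w_def degree_prod_eq_sum_degree del: prod.lessThan_Suc)
  qed auto
  ultimately show ?thesis by (simp add: linear_code_def)
qed

section \<open>Roots of subfield elements\<close>

lemma norm_surjective_on_subfield:
  fixes \<theta> y :: "'a::field"
  assumes gen: "\<And>x. x \<noteq> 0 \<Longrightarrow> \<exists>i. x = \<theta> ^ i" and ord: "\<And>m. \<theta> ^ m = 1 \<longleftrightarrow> M dvd m"
    and Q: "Q > 1" "(Q + 1) * (Q - 1) dvd M" and y: "y \<noteq> 0" "y ^ Q = y"
  shows "\<exists>z. z ^ (Q + 1) = y"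
proof -
  obtain i where i: "y = \<theta> ^ i" using gen y(1) by blast
  \<comment> \<open>Being fixed by the \<open>Q\<close>-th power, \<open>y\<close> has order
    dividing \<open>Q - 1\<close>. As \<open>(Q + 1) * (Q - 1)\<close> divides the order of
    \<open>\<theta>\<close>, the exponent \<open>i\<close> is a multiple of
    \<open>Q + 1\<close>.\<close>
  have "y * y ^ (Q - 1) = y" using Q(1) y(2) by (simp add: power_eq_if)
  then have "y ^ (Q - 1) = 1" using y(1) by simp
  then have "\<theta> ^ (i * (Q - 1)) = 1" by (simp only: i power_mult)
  then have "(Q + 1) * (Q - 1) dvd i * (Q - 1)" using ord Q(2) dvd_trans by blast
  then have "(Q - 1) * (Q + 1) dvd (Q - 1) * i" by (simp only: mult.commute)
  then have "Q + 1 dvd i"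
    using Q(1) nat_mult_dvd_cancel_disj[of "Q - 1" "Q + 1" i] by linarith
  then obtain j where j: "i = j * (Q + 1)" by (metis dvd_div_mult_self)
  have "y = (\<theta> ^ j) ^ (Q + 1)" unfolding i j by (rule power_mult)
  then show ?thesis by blast
qed

lemma diff_one_dvd_power_diff_one: "x - 1 dvd x ^ c - 1" for x c :: nat
proof (induction c)
  case (Suc c)
  show ?case
  proof (cases "x = 0")
    case False
    then have "x ^ Suc c - 1 = x * (x ^ c - 1) + (x - 1)"
      by (simp add: diff_mult_distrib2)
    with Suc show ?thesis by simp
  qed simp
qed simp

section \<open>Assembling the code\<close>

theorem mainTheorem8:
  fixes p e q l x1 x2 r1 n s k h :: nat
  assumes "prime p" and "q = p ^ e" and "q > 4"
    and "CARD('a) = q"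
    and "l > 0" and "2 * l dvd e"
    and "x1 > 0" and "x2 > 0"
    and "(q - 1) dvd lcm x1 x2"
    and "((q - 1) div (p ^ l - 1)) dvd x1"
    and "1 \<le> r1" and "r1 \<le> (q - 1) div gcd x1 (q - 1)"
    and "n = r1 * ((q - 1) div gcd x2 (q - 1))"
    and "s \<ge> 1"
    and "s + 1 \<le> k" and "k \<le> (p ^ l + n) div (p ^ l + 1)"
    and "h \<le> k - s - 1"
  shows "\<exists>C :: 'a::{field,finite} vec set. linear_code (n + s) k C \<and> is_grl_code n s k C \<and>
           subspace_dim (n + s) (galois_hull p l (n + s) C) = h"
proof -
  define Q where "Q = p ^ l"
  define M where "M = q - 1"
  define N where "N = M div gcd x2 M"
  define N1 where "N1 = M div gcd x1 M"
  have M: "M > 0" using assms(3) by (simp add: M_def)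
  have "p > 1" using \<open>prime p\<close> by (rule prime_gt_1_nat)
  have Q: "Q > 1" unfolding Q_def using \<open>p > 1\<close> \<open>l > 0\<close> by (rule one_less_power)
  obtain c where c: "e = 2 * l * c" using assms(6) by auto
  \<comment> \<open>The assumption \<open>2 * l dvd e\<close> makes \<open>q\<close> a power of the
    square of \<open>Q\<close>, whence \<open>(Q + 1) * (Q - 1)\<close> divides
    \<open>q - 1\<close>, as the extraction of roots requires.\<close>
  have q: "q = (Q\<^sup>2) ^ c"
    unfolding assms(2) Q_def c by (simp flip: power_mult add: ac_simps)
  have QQ: "(Q + 1) * (Q - 1) = Q\<^sup>2 - 1"
    by (simp add: power2_eq_square algebra_simps diff_mult_distrib2)
  then have QM: "(Q + 1) * (Q - 1) dvd M"
    using diff_one_dvd_power_diff_one[of "Q\<^sup>2" c] by (simp add: q M_def)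
  have n: "n = r1 * N" using assms(13) by (simp add: N_def M_def)
  have r1: "r1 \<le> N1" using assms(12) by (simp add: N1_def M_def)
  have "N > 0" using M by (simp add: N_def div_greater_zero_iff)

  obtain \<theta> :: 'a where \<theta>: "\<theta> \<noteq> 0" and gen: "\<And>x. x \<noteq> 0 \<Longrightarrow> \<exists>i. x = \<theta> ^ i"
    and ord: "\<And>m. \<theta> ^ m = 1 \<longleftrightarrow> M dvd m"
    using finite_field_generator[where 'a = 'a] unfolding assms(4) M_def[symmetric] by blast
  define \<xi> where "\<xi> = \<theta> ^ x1"
  define \<eta> where "\<eta> = \<theta> ^ x2"
  have \<xi>: "\<xi> \<noteq> 0" and \<eta>: "\<eta> \<noteq> 0" using \<theta> by (auto simp: \<xi>_def \<eta>_def)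
  have ord_\<xi>: "\<xi> ^ m = 1 \<longleftrightarrow> N1 dvd m" for m
    unfolding \<xi>_def N1_def power_mult[symmetric] ord by (rule dvd_mult_iff_div_gcd[OF M])
  have ord_\<eta>: "\<eta> ^ m = 1 \<longleftrightarrow> N dvd m" for m
    unfolding \<eta>_def N_def power_mult[symmetric] ord by (rule dvd_mult_iff_div_gcd[OF M])
  have "coprime N1 N"
    unfolding N1_def N_def using M assms(9) by (intro coprime_div_gcd) (auto simp: M_def)

  \<comment> \<open>\<open>b i\<close> is the common \<open>N\<close>-th power of the points in
    coset \<open>i\<close>, so distinct values of \<open>b\<close> separate the cosets. Coprimality
    of \<open>N1\<close> and \<open>N\<close> together with \<open>r1 \<le> N1\<close> makes them
    distinct.\<close>
  define b where "b i = \<xi> ^ (i * N)" for i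
  define a where "a i = \<xi> ^ (i div N) * \<eta> ^ (i mod N)" for i
  define w where "w i = inverse (b i * (\<Prod>j\<in>{..<r1} - {i}. b i - b j))" for i
  have inj_b: "inj_on b {..<r1}"
  proof (rule linorder_inj_onI)
    fix i j assume ij: "i < j" "i \<in> {..<r1}" "j \<in> {..<r1}"
    show "b i \<noteq> b j"
    proof
      assume "b i = b j"
      then have "\<xi> ^ (j * N - i * N) = 1"
        using power_diff[OF \<xi>, of "i * N" "j * N"] ij(1) \<xi> by (simp add: b_def)
      then have "N1 dvd (j - i) * N" by (simp add: ord_\<xi> diff_mult_distrib)
      then have "N1 dvd j - i" using \<open>coprime N1 N\<close> by (simp add: coprime_dvd_mult_left_iff)
      then have "N1 \<le> j - i" using ij(1) by (intro dvd_imp_le) auto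
      then show False using ij r1 by auto
    qed
  qed auto
  have inj_a: "inj_on a {..<n}"
  proof (rule inj_onI)
    fix i j assume ij: "i \<in> {..<n}" "j \<in> {..<n}" "a i = a j"
    have aN: "a m ^ N = b (m div N)" for m
    proof -
      have "(\<eta> ^ (m mod N)) ^ N = 1" using ord_\<eta> by (simp flip: power_mult)
      then show ?thesis by (simp add: a_def b_def power_mult_distrib power_mult)
    qed
    have "i div N \<in> {..<r1}" "j div N \<in> {..<r1}"
      using ij n by (auto simp: less_mult_imp_div_less)
    then have div: "i div N = j div N"
      using inj_onD[OF inj_b, of "i div N" "j div N"] aN[of i] aN[of j] ij(3) by simp
    then have \<eta>_eq: "\<eta> ^ (i mod N) = \<eta> ^ (j mod N)" using ij(3) \<xi> by (simp add: a_def)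
    have "inj_on (\<lambda>m. \<eta> ^ m) {..<N}"
    proof (rule linorder_inj_onI)
      fix i j assume ij: "i < j" "i \<in> {..<N}" "j \<in> {..<N}"
      then have "\<not> N dvd j - i" by (intro nat_dvd_not_less) auto
      then show "\<eta> ^ i \<noteq> \<eta> ^ j"
        using power_diff[OF \<eta>, of i j] ij(1) \<eta> ord_\<eta>[of "j - i"] by auto
    qed auto
    then have "i mod N = j mod N" using \<eta>_eq \<open>N > 0\<close> by (auto dest: inj_onD)
    with div show "i = j" by (metis div_mult_mod_eq)
  qed

  have w_ne: "w i \<noteq> 0" if "i < r1" for i
  proof -
    have "b i \<noteq> 0" using \<xi> by (simp add: b_def)
    moreover have "(\<Prod>j\<in>{..<r1} - {i}. b i - b j) \<noteq> 0"
      using inj_onD[OF inj_b, of i] that by auto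
    ultimately show ?thesis by (simp add: w_def)
  qed
  have frob: "(x - y) ^ Q = x ^ Q - y ^ Q" for x y :: 'a
    unfolding Q_def using assms(1,2,4) by (intro frobenius_diff) auto
  \<comment> \<open>Divisibility of \<open>x1\<close> by \<open>M div (Q - 1)\<close> puts
    \<open>\<xi>\<close> in the subfield fixed by the \<open>Q\<close>-th power. The
    \<open>b i\<close> follow as powers, and the weights as the Frobenius map respects products,
    inverses and differences.\<close>
  have "M div (Q - 1) * (Q - 1) = M"
    using QM dvd_mult_right by (intro dvd_div_mult_self) blast
  then have "M dvd x1 * (Q - 1)"
    using assms(10) by (metis M_def Q_def dvd_refl mult_dvd_mono)
  then have "\<xi> ^ (Q - 1) = 1" by (simp add: \<xi>_def ord flip: power_mult)
  then have "\<xi> ^ Q = \<xi>" using Q by (simp add: power_eq_if)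
  then have bQ: "b i ^ Q = b i" for i by (metis b_def mult.commute power_mult)
  then have "w i ^ Q = w i" for i
    by (simp add: w_def power_inverse power_mult_distrib prod_power_distrib frob)
  then have "\<forall>i\<in>{..<r1}. \<exists>z. z ^ (Q + 1) = w i"
    using norm_surjective_on_subfield[OF gen ord Q QM] w_ne by blast
  then obtain \<rho> where \<rho>: "\<And>i. i < r1 \<Longrightarrow> \<rho> i ^ (Q + 1) = w i"
    by (metis lessThan_iff)

  \<comment> \<open>Each rescaled coordinate lowers the hull dimension by one from its value
    \<open>k - s - 1\<close> at \<open>t = 0\<close>.\<close>
  define t where "t = k - s - 1 - h"
  have k: "h + t + s + 1 = k" using assms(15,17) by (simp add: t_def)
  have "k * (Q + 1) \<le> Q + n"
    using assms(16) by (simp add: less_eq_div_iff_mult_less_eq Q_def)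
  moreover have "k * (Q + 1) = (Q + 1) * (k - 1) + (Q + 1)" using k by (cases k) auto
  ultimately have kn: "(Q + 1) * (k - 1) < n" by linarith
  then have "k \<le> n" by simp
  define A where "A = vec n a"
  define v where "v = vec n (\<lambda>i. \<rho> (i div N) * (if i < t then \<theta> else 1))"
  have div_less: "i div N < r1" if "i < n" for i
    using that n by (simp add: less_mult_imp_div_less)
  have \<rho>_ne: "\<rho> i \<noteq> 0" if "i < r1" for i
    using \<rho>[OF that] w_ne[OF that] by auto
  have A_inj: "inj_on (($) A) {..<n}"
    using inj_a by (simp add: A_def inj_on_def)
  have v_ne: "v $ i \<noteq> 0" if "i < n" for i
    using \<rho>_ne[OF div_less[OF that]] that \<theta> by (simp add: v_def)
  define C where "C = grl_set n s k A v (1\<^sub>m s)"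

  \<comment> \<open>Otherwise \<open>(Q + 1) * (Q - 1)\<close> divides \<open>Q + 1\<close>, so
    \<open>Q = 2\<close> and \<open>q - 1\<close> divides \<open>3\<close>, contradicting
    \<open>q > 4\<close>.\<close>
  have ne: "\<theta> ^ (Q + 1) \<noteq> 1"
  proof
    assume "\<theta> ^ (Q + 1) = 1"
    then have MQ: "M dvd Q + 1" by (simp only: ord)
    then have "(Q + 1) * (Q - 1) dvd (Q + 1) * 1"
      using dvd_trans[OF QM] by (simp only: mult_1_right)
    then have "Q - 1 dvd 1"
      using nat_mult_dvd_cancel_disj[of "Q + 1" "Q - 1" 1] by linarith
    then have "Q = 2" using Q by simp
    with MQ show False using assms(3) by (auto simp: M_def dest: dvd_imp_le)
  qed
  have "subspace_dim (n + s) (galois_hull p l (n + s) C) = h"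
    unfolding C_def
  proof (rule grl_hull_dimension[where \<omega> = "\<lambda>i. w (i div N)" and t = t and \<gamma> = "\<theta> ^ (Q + 1)"
        and \<zeta> = "\<Sum>i<r1 * N. w (i div N)", OF A_inj _ v_ne])
    show "A $ i \<noteq> 0" if "i < n" for i using that \<xi> \<eta> by (simp add: A_def a_def)
    show "v $ i ^ (p ^ l + 1) = w (i div N) * (if i < t then \<theta> ^ (Q + 1) else 1)" if "i < n" for i
      using \<rho>[OF div_less[OF that]] that
      by (simp add: v_def Q_def power_mult_distrib ac_simps)
    show "(\<Sum>i<n. w (i div N) * poly F (A $ i)) = (\<Sum>i<r1 * N. w (i div N)) * poly F 0"
      if "degree F < n" for F
    proof -
      have "(\<Sum>i<n. w (i div N) * poly F (A $ i)) = (\<Sum>i<r1 * N. w (i div N) * poly F (a i))"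
        by (simp add: A_def n)
      also have "\<dots> = (\<Sum>i<r1 * N. w (i div N)) * poly F 0"
        unfolding a_def
      proof (rule coset_power_sums[OF \<open>N > 0\<close> _ _ \<xi> b_def inj_b w_def])
        show "\<eta> ^ j \<noteq> 1" if "0 < j" "j < N" for j
          using that nat_dvd_not_less by (simp add: ord_\<eta>)
      qed (use that n ord_\<eta> in auto)
      finally show ?thesis .
    qed
    show "(p ^ l + 1) * (k - 1) < n" using kn by (simp add: Q_def)
  qed (use ne \<open>p > 1\<close> k in auto)
  moreover have "is_grl_code n s k C"
    unfolding is_grl_code_def
  proof (intro conjI exI)
    show "C = grl_set n s k A v (1\<^sub>m s)" by (rule C_def)
    show "\<forall>i<n. \<forall>j<n. i \<noteq> j \<longrightarrow> A $ i \<noteq> A $ j" using A_inj by (auto dest: inj_onD)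
    show "invertible_mat (1\<^sub>m s :: 'a mat)"
      unfolding invertible_mat_def inverts_mat_def by (auto intro!: exI[of _ "1\<^sub>m s"])
  qed (use \<open>k \<le> n\<close> k assms(14) v_ne in \<open>auto simp: A_def v_def\<close>)
  moreover have "linear_code (n + s) k C"
  proof -
    have "C = (\<lambda>f. grl_codeword n s k A v (1\<^sub>m s) (1 * f)) ` {f. \<forall>i\<ge>k. coeff f i = 0}"
      using k by (auto simp: C_def grl_set_def coeff_eq_0_iff_degree_less)
    also have "linear_code (n + s) k \<dots>"
      using \<open>k \<le> n\<close> by (intro linear_code_grl_multiples A_inj v_ne) auto
    finally show ?thesis .
  qed
  ultimately show ?thesis by blast
qed

end
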